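(* Let $\alpha,\beta\in\mathbb R_0^+$ with $\alpha+\beta\ne0$, let $f,g:\mathbb R\to\mathbb R$ and let $a,b\in\mathbb R$ with $a<b$ be such that $b\in\mathcal A:=\{a+k\alpha:k\in\mathbb N_0\}$ and $a\in\mathcal B:=\{b-k\beta:k\in\mathbb N_0\}$. If $f$ and $g$ are $\alpha,\beta$-symmetric integrable on $[a,b]$, then, for any $p>1$, $$\left(\int_a^b|f(t)+g(t)|^p\,d_{\alpha,\beta}t\right)^{\frac1p}\le\left(\int_a^b|f(t)|^p\,d_{\alpha,\beta}t\right)^{\frac1p}+\left(\int_a^b|g(t)|^p\,d_{\alpha,\beta}t\right)^{\frac1p}.$$
   Context: $\mathbb R_0^+=[0,\infty)$, $\mathbb N_0=\{0,1,2,\dots\}$. For $\alpha>0$, the $\alpha$-forward integral of $f:\mathbb R\to\mathbb R$ is $\int_a^bf(t)\Delta_\alpha t=\int_a^{+\infty}f(t)\Delta_\alpha t-\int_b^{+\infty}f(t)\Delta_\alpha t$, where $\int_x^{+\infty}f(t)\Delta_\alpha t=\alpha\sum_{k=0}^{+\infty}f(x+k\alpha)$; $f$ is $\alpha$-forward integrable on $[a,b]$ if the series converges at $x=a$ and $x=b$. For $\beta>0$, the $\beta$-backward integral is $\int_a^bf(t)\nabla_\beta t=\int_{-\infty}^bf(t)\nabla_\beta t-\int_{-\infty}^af(t)\nabla_\beta t$, where $\int_{-\infty}^xf(t)\nabla_\beta t=\beta\sum_{k=0}^{+\infty}f(x-k\beta)$; $f$ is $\beta$-backward integrable on $[a,b]$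 if the series converges at $x=a$ and $x=b$. For $\alpha,\beta\ge0$ with $\alpha+\beta>0$, $f$ is $\alpha,\beta$-symmetric integrable on $[a,b]$ if it is $\alpha$-forward and $\beta$-backward integrable on $[a,b]$ (if $\beta=0$ only the forward, if $\alpha=0$ only the backward integrability is required), and then $$\int_a^bf(t)\,d_{\alpha,\beta}t=\frac{\alpha}{\alpha+\beta}\int_a^bf(t)\Delta_\alpha t+\frac{\beta}{\alpha+\beta}\int_a^bf(t)\nabla_\beta t,$$ a term with coefficient $0$ being omitted.
   Formalization: It is additionally assumed that |f|^p and |g|^p are α,β-symmetric integrable on [a,b], since integrability of f and g does not ensure that the right-hand integrals exist; integrability of |f+g|^p is proved. *)

theory Defs
  imports Complex_Main
begin

definition forward_tail :: "real \<Rightarrow> (real \<Rightarrow> real) \<Rightarrow> real \<Rightarrow> real" where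
  "forward_tail \<alpha> f x = \<alpha> * (\<Sum>k. f (x + real k * \<alpha>))"

definition forward_integrable :: "real \<Rightarrow> (real \<Rightarrow> real) \<Rightarrow> real \<Rightarrow> real \<Rightarrow> bool" where
  "forward_integrable \<alpha> f a b \<longleftrightarrow>
     summable (\<lambda>k. f (a + real k * \<alpha>)) \<and> summable (\<lambda>k. f (b + real k * \<alpha>))"

definition forward_integral :: "real \<Rightarrow> (real \<Rightarrow> real) \<Rightarrow> real \<Rightarrow> real \<Rightarrow> real" where
  "forward_integral \<alpha> f a b = forward_tail \<alpha> f a - forward_tail \<alpha> f b"

definition backward_tail :: "real \<Rightarrow> (real \<Rightarrow> real) \<Rightarrow> real \<Rightarrow> real" where
  "backward_tail \<beta> f x = \<beta> * (\<Sum>k. f (x - real k * \<beta>))"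

definition backward_integrable :: "real \<Rightarrow> (real \<Rightarrow> real) \<Rightarrow> real \<Rightarrow> real \<Rightarrow> bool" where
  "backward_integrable \<beta> f a b \<longleftrightarrow>
     summable (\<lambda>k. f (a - real k * \<beta>)) \<and> summable (\<lambda>k. f (b - real k * \<beta>))"

definition backward_integral :: "real \<Rightarrow> (real \<Rightarrow> real) \<Rightarrow> real \<Rightarrow> real \<Rightarrow> real" where
  "backward_integral \<beta> f a b = backward_tail \<beta> f b - backward_tail \<beta> f a"

text \<open>The notions below are meant for nonnegative steps, not both zero. A zero step imposes no
  integrability condition, and its term in the integral vanishes because its coefficient is zero.\<close>

definition symmetric_integrable ::
    "real \<Rightarrow> real \<Rightarrow> (real \<Rightarrow> real) \<Rightarrow> real \<Rightarrow> real \<Rightarrow> bool" where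
  "symmetric_integrable \<alpha> \<beta> f a b \<longleftrightarrow>
     (\<alpha> \<noteq> 0 \<longrightarrow> forward_integrable \<alpha> f a b) \<and> (\<beta> \<noteq> 0 \<longrightarrow> backward_integrable \<beta> f a b)"

text \<open>The value is meaningful only when \<open>symmetric_integrable\<close> holds: \<^const>\<open>suminf\<close> of a divergent
  series is an unspecified number.\<close>

definition symmetric_integral ::
    "real \<Rightarrow> real \<Rightarrow> (real \<Rightarrow> real) \<Rightarrow> real \<Rightarrow> real \<Rightarrow> real" where
  "symmetric_integral \<alpha> \<beta> f a b =
     \<alpha> / (\<alpha> + \<beta>) * forward_integral \<alpha> f a b + \<beta> / (\<alpha> + \<beta>) * backward_integral \<beta> f a b"

end

theory Submission imports Defs "HOL-Analysis.Convex" begin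

text \<open>Since \<open>b\<close> lies on the forward lattice of \<open>a\<close> and \<open>a\<close> on the backward lattice of \<open>b\<close>, both steps
  are positive and the series telescope: on integrable functions the symmetric integral is a finite
  sum with nonnegative weights. Minkowski's inequality for such sums follows from convexity of
  \<open>x \<mapsto> x powr p\<close>, applied to \<open>\<bar>x + y\<bar> / (A + B)\<close> as a convex combination of \<open>\<bar>x\<bar> / A\<close> and \<open>\<bar>y\<bar> / B\<close>
  for arbitrary positive \<open>A\<close>, \<open>B\<close> exceeding the two norms.\<close>

text \<open>For positive \<open>x\<close> and \<open>y\<close> this is convexity of the power
  function. If one of them vanishes, only the bound \<open>u powr p \<le> u\<close> or
  \<open>v powr p \<le> v\<close> is left, true because both weights are at most 1.\<close>

lemma powr_convex_combination:
  fixes x y u v p :: real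
  assumes "p \<ge> 1" "x \<ge> 0" "y \<ge> 0" "u > 0" "v > 0" "u + v = 1"
  shows "(u * x + v * y) powr p \<le> u * x powr p + v * y powr p"
proof (cases "x = 0 \<or> y = 0")
  case True
  have "u powr p \<le> u" "v powr p \<le> v"
    using assms powr_mono'[of 1 p u] powr_mono'[of 1 p v] by auto
  with True assms show ?thesis
    by (auto simp: powr_mult intro!: mult_right_mono)
next
  case False
  with assms show ?thesis
    using convex_onD[OF powr_convex[of p], of v x y] by (simp add: eq_diff_eq[symmetric])
qed

text \<open>The pointwise core of Minkowski: when \<open>A\<close> and \<open>B\<close> dominate the
  two norms, summing the bracket gives at most 1, so only \<open>(A + B) powr p\<close>
  remains.\<close>

lemma abs_add_powr_le:
  fixes x y A B p :: real
  assumes "p \<ge> 1" "A > 0" "B > 0"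
  shows "\<bar>x + y\<bar> powr p \<le>
    (A + B) powr p * (A / (A + B) * (\<bar>x\<bar> powr p / A powr p) + B / (A + B) * (\<bar>y\<bar> powr p / B powr p))"
proof -
  let ?z = "A / (A + B) * (\<bar>x\<bar> / A) + B / (A + B) * (\<bar>y\<bar> / B)"
  have "?z = (\<bar>x\<bar> + \<bar>y\<bar>) / (A + B)"
    using assms by (simp add: add_divide_distrib)
  then have "(A + B) * ?z = \<bar>x\<bar> + \<bar>y\<bar>"
    using assms by simp
  then have "\<bar>x + y\<bar> powr p \<le> ((A + B) * ?z) powr p"
    using assms by (intro powr_mono2) auto
  also have "\<dots> = (A + B) powr p * ?z powr p"
    by (rule powr_mult)
  also have "?z powr p \<le> A / (A + B) * (\<bar>x\<bar> / A) powr p + B / (A + B) * (\<bar>y\<bar> / B) powr p"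
    using assms by (intro powr_convex_combination) (auto simp: add_divide_distrib[symmetric])
  finally show ?thesis
    using assms by (simp add: powr_divide mult_left_mono)
qed

text \<open>Needed because the integrability of \<open>\<bar>f + g\<bar> powr p\<close> is part of
  the conclusion, and the telescoping of its integral rests on it.\<close>

lemma summable_abs_add_powr:
  fixes u v :: "nat \<Rightarrow> real"
  assumes "p \<ge> 1" "summable (\<lambda>k. \<bar>u k\<bar> powr p)" "summable (\<lambda>k. \<bar>v k\<bar> powr p)"
  shows "summable (\<lambda>k. \<bar>u k + v k\<bar> powr p)"
proof (rule summable_comparison_test')
  show "summable (\<lambda>k. 2 powr p * (1 / 2 * \<bar>u k\<bar> powr p + 1 / 2 * \<bar>v k\<bar> powr p))"
    by (intro summable_mult summable_add assms)
  show "norm (\<bar>u k + v k\<bar> powr p) \<le> 2 powr p * (1 / 2 * \<bar>u k\<bar> powr p + 1 / 2 * \<bar>v k\<bar> powr p)"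
    if "k \<ge> 0" for k
    \<comment> \<open>Taking \<open>A = B = 1\<close> produces the factor \<open>2 powr p\<close>
      and the weights 1/2.\<close>
    using abs_add_powr_le[OF assms(1), of 1 1 "u k" "v k"] by simp
qed

lemma symmetric_integrable_abs_add_powr:
  assumes "p \<ge> 1"
    and "symmetric_integrable \<alpha> \<beta> (\<lambda>t. \<bar>f t\<bar> powr p) a b"
    and "symmetric_integrable \<alpha> \<beta> (\<lambda>t. \<bar>g t\<bar> powr p) a b"
  shows "symmetric_integrable \<alpha> \<beta> (\<lambda>t. \<bar>f t + g t\<bar> powr p) a b"
  using assms unfolding symmetric_integrable_def forward_integrable_def backward_integrable_def
  by (auto intro: summable_abs_add_powr)

lemma minkowski_sum:
  fixes w u v :: "'i \<Rightarrow> real"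
  assumes p: "p \<ge> 1" and w: "\<And>i. i \<in> I \<Longrightarrow> w i \<ge> 0"
  shows "(\<Sum>i\<in>I. w i * \<bar>u i + v i\<bar> powr p) powr (1 / p) \<le>
    (\<Sum>i\<in>I. w i * \<bar>u i\<bar> powr p) powr (1 / p) + (\<Sum>i\<in>I. w i * \<bar>v i\<bar> powr p) powr (1 / p)"
    (is "?S powr _ \<le> ?U powr _ + ?V powr _")
proof (rule field_le_epsilon)
  fix e :: real
  assume e: "e > 0"
  \<comment> \<open>The summand \<open>e / 2\<close> keeps \<open>A\<close> and \<open>B\<close>
    positive even when a norm is zero; the two halves add up to the slack \<open>e\<close>.\<close>
  define A where "A = ?U powr (1 / p) + e / 2"
  define B where "B = ?V powr (1 / p) + e / 2"
  have A: "A > 0" and B: "B > 0"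
    using e by (auto simp: A_def B_def intro: add_nonneg_pos)
  have nonneg: "?S \<ge> 0" "?U \<ge> 0" "?V \<ge> 0"
    using w by (auto intro: sum_nonneg)
  have "(?U powr (1 / p)) powr p \<le> A powr p" "(?V powr (1 / p)) powr p \<le> B powr p"
    using e p by (auto simp: A_def B_def intro!: powr_mono2)
  then have UV: "?U / A powr p \<le> 1" "?V / B powr p \<le> 1"
    using nonneg p A B by (simp_all add: powr_powr)
  have "?S \<le> (\<Sum>i\<in>I. w i * ((A + B) powr p * (A / (A + B) * (\<bar>u i\<bar> powr p / A powr p) +
      B / (A + B) * (\<bar>v i\<bar> powr p / B powr p))))"
    by (intro sum_mono mult_left_mono abs_add_powr_le p A B w)
  also have "\<dots> = (A + B) powr p * (A / (A + B) * (?U / A powr p) + B / (A + B) * (?V / B powr p))"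
    by (simp add: sum_distrib_left sum_divide_distrib sum.distrib[symmetric] algebra_simps)
  also have "\<dots> \<le> (A + B) powr p * (A / (A + B) * 1 + B / (A + B) * 1)"
    using A B UV by (intro mult_left_mono add_mono) auto
  also have "\<dots> = (A + B) powr p"
    using A B by (simp add: add_divide_distrib[symmetric])
  finally have "?S powr (1 / p) \<le> ((A + B) powr p) powr (1 / p)"
    using nonneg p by (intro powr_mono2) auto
  also have "\<dots> = A + B"
    using A B p by (simp add: powr_powr)
  finally show "?S powr (1 / p) \<le> ?U powr (1 / p) + ?V powr (1 / p) + e"
    by (simp add: A_def B_def)
qed

text \<open>The series at \<open>b\<close> is the series at \<open>a\<close> without its first
  \<open>n\<close> terms, so the tails cancel; the endpoint \<open>b\<close> is not sampled.\<close>

lemma forward_integral_eq_sum: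
  assumes "forward_integrable \<alpha> h a b" and b: "b = a + real n * \<alpha>"
  shows "forward_integral \<alpha> h a b = \<alpha> * (\<Sum>i<n. h (a + real i * \<alpha>))"
proof -
  have "(\<Sum>k. h (a + real k * \<alpha>)) =
      (\<Sum>k. h (a + real (k + n) * \<alpha>)) + (\<Sum>i<n. h (a + real i * \<alpha>))"
    using assms(1) unfolding forward_integrable_def by (intro suminf_split_initial_segment) auto
  then show ?thesis
    by (simp add: forward_integral_def forward_tail_def b algebra_simps)
qed

lemma backward_integral_eq_sum:
  assumes "backward_integrable \<beta> h a b" and a: "a = b - real m * \<beta>"
  shows "backward_integral \<beta> h a b = \<beta> * (\<Sum>j<m. h (b - real j * \<beta>))"
proof -
  have "(\<Sum>k. h (b - real k * \<beta>)) =
      (\<Sum>k. h (b - real (k + m) * \<beta>)) + (\<Sum>j<m. h (b - real j * \<beta>))"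
    using assms(1) unfolding backward_integrable_def by (intro suminf_split_initial_segment) auto
  then show ?thesis
    by (simp add: backward_integral_def backward_tail_def a algebra_simps)
qed

text \<open>The disjoint sum of index sets merges both lattices into one weighted sum, so that a
  single use of \<open>minkowski_sum\<close> covers both parts of the integral.\<close>

lemma symmetric_integral_eq_sum:
  assumes "symmetric_integrable \<alpha> \<beta> h a b" "\<alpha> \<noteq> 0" "\<beta> \<noteq> 0"
    and "b = a + real n * \<alpha>" "a = b - real m * \<beta>"
  shows "symmetric_integral \<alpha> \<beta> h a b = (\<Sum>s\<in>{..<n} <+> {..<m}.
      case_sum (\<lambda>i. \<alpha> / (\<alpha> + \<beta>) * \<alpha>) (\<lambda>j. \<beta> / (\<alpha> + \<beta>) * \<beta>) s *
      h (case_sum (\<lambda>i. a + real i * \<alpha>) (\<lambda>j. b - real j * \<beta>) s))"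
proof -
  have "forward_integral \<alpha> h a b = \<alpha> * (\<Sum>i<n. h (a + real i * \<alpha>))"
    "backward_integral \<beta> h a b = \<beta> * (\<Sum>j<m. h (b - real j * \<beta>))"
    using assms(1-3) forward_integral_eq_sum[OF _ assms(4)] backward_integral_eq_sum[OF _ assms(5)]
    unfolding symmetric_integrable_def by blast+
  then show ?thesis
    by (simp add: symmetric_integral_def sum.Plus sum_distrib_left mult.assoc)
qed

theorem theorem5p3p19:
  fixes \<alpha> \<beta> a b p :: real and f g :: "real \<Rightarrow> real"
  assumes "\<alpha> \<ge> 0" and "\<beta> \<ge> 0" and "\<alpha> + \<beta> \<noteq> 0"
    and "a < b"
    and "b \<in> {a + real k * \<alpha> | k :: nat. True}"
    and "a \<in> {b - real k * \<beta> | k :: nat. True}"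
    and "symmetric_integrable \<alpha> \<beta> f a b"
    and "symmetric_integrable \<alpha> \<beta> g a b"
    and "p > 1"
    and "symmetric_integrable \<alpha> \<beta> (\<lambda>t. \<bar>f t\<bar> powr p) a b"
    and "symmetric_integrable \<alpha> \<beta> (\<lambda>t. \<bar>g t\<bar> powr p) a b"
  shows "symmetric_integrable \<alpha> \<beta> (\<lambda>t. \<bar>f t + g t\<bar> powr p) a b \<and>
    (symmetric_integral \<alpha> \<beta> (\<lambda>t. \<bar>f t + g t\<bar> powr p) a b) powr (1 / p)
      \<le> (symmetric_integral \<alpha> \<beta> (\<lambda>t. \<bar>f t\<bar> powr p) a b) powr (1 / p)
        + (symmetric_integral \<alpha> \<beta> (\<lambda>t. \<bar>g t\<bar> powr p) a b) powr (1 / p)"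
proof -
  obtain n where n: "b = a + real n * \<alpha>"
    using assms(5) by auto
  obtain m where m: "a = b - real m * \<beta>"
    using assms(6) by auto
  \<comment> \<open>A zero step would force \<open>a = b\<close>.\<close>
  have nz: "\<alpha> \<noteq> 0" "\<beta> \<noteq> 0"
    using n m \<open>a < b\<close> by auto
  have int: "symmetric_integrable \<alpha> \<beta> (\<lambda>t. \<bar>f t + g t\<bar> powr p) a b"
    using assms by (intro symmetric_integrable_abs_add_powr) auto
  show ?thesis
    unfolding symmetric_integral_eq_sum[OF int nz n m] symmetric_integral_eq_sum[OF assms(10) nz n m]
      symmetric_integral_eq_sum[OF assms(11) nz n m]
    using assms by (intro conjI int minkowski_sum) (auto split: sum.split)
qed

end
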